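(* Let $k\ge1$ and $t\ge 1$ be integers and let $c\colon E(K_{2kt+1})\to[k]$ be a $k$-edge-colouring of the complete graph $K_{2kt+1}$. Suppose that, for every $j\in[k]$ and every set $S\subseteq[k]$ of $j$ colours, there are strictly more than $\binom{2jt}{2}$ edges $e$ of $K_{2kt+1}$ with $c(e)\in S$. Then there exists a colour-balanced spanning tree of $K_{2kt+1}$.
   Context: $[k]=\{1,\dots,k\}$. A $k$-edge-colouring is an arbitrary (not necessarily proper) map from the edge set to $[k]$. A subgraph is colour-balanced if each of the $k$ colours appears on equally many of its edges (so a colour-balanced spanning tree of $K_{2kt+1}$ has exactly $2t$ edges of each colour). *)

theory Defs
  imports Complex_Main
begin

text \<open>
  Undirected simple graphs, with edges as two-element sets of vertices.  The AFP entry
  Graph_Theory models graphs as symmetric digraphs; there a directed walk \<open>a, b, a\<close> counts as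
  a cycle, and its notion of forest only excludes directed cycles, so its trees are not the
  undirected ones needed here.
\<close>

record 'a ugraph =
  uverts :: "'a set"
  uedges :: "'a set set"

definition simple_ugraph :: "'a ugraph \<Rightarrow> bool" where
  "simple_ugraph G \<longleftrightarrow> finite (uverts G) \<and> (\<forall>e\<in>uedges G. e \<subseteq> uverts G \<and> card e = 2)"

definition complete_ugraph :: "'a set \<Rightarrow> 'a ugraph" where
  "complete_ugraph V = \<lparr> uverts = V, uedges = {e. e \<subseteq> V \<and> card e = 2} \<rparr>"

definition usubgraph :: "'a ugraph \<Rightarrow> 'a ugraph \<Rightarrow> bool" where
  "usubgraph H G \<longleftrightarrow> simple_ugraph H \<and> uverts H \<subseteq> uverts G \<and> uedges H \<subseteq> uedges G"

text \<open>Walks and cycles are given by their vertex sequences; the edge from the last vertex of a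
  cycle back to its first one is implicit.\<close>

definition uwalk :: "'a ugraph \<Rightarrow> 'a list \<Rightarrow> bool" where
  "uwalk G p \<longleftrightarrow> p \<noteq> [] \<and> set p \<subseteq> uverts G \<and> successively (\<lambda>x y. {x, y} \<in> uedges G) p"

definition ucycle :: "'a ugraph \<Rightarrow> 'a list \<Rightarrow> bool" where
  "ucycle G p \<longleftrightarrow> uwalk G p \<and> 3 \<le> length p \<and> distinct p \<and> {last p, hd p} \<in> uedges G"

definition uconnected :: "'a ugraph \<Rightarrow> bool" where
  "uconnected G \<longleftrightarrow> uverts G \<noteq> {} \<and>
     (\<forall>u\<in>uverts G. \<forall>v\<in>uverts G. \<exists>p. uwalk G p \<and> hd p = u \<and> last p = v)"

definition utree :: "'a ugraph \<Rightarrow> bool" where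
  "utree G \<longleftrightarrow> simple_ugraph G \<and> uconnected G \<and> (\<nexists>p. ucycle G p)"

definition uspanning_tree :: "'a ugraph \<Rightarrow> 'a ugraph \<Rightarrow> bool" where
  "uspanning_tree T G \<longleftrightarrow> utree T \<and> usubgraph T G \<and> uverts T = uverts G"

text \<open>Not necessarily proper; the values of \<open>c\<close> outside the edge set are irrelevant.\<close>

definition edge_colouring :: "nat \<Rightarrow> 'a ugraph \<Rightarrow> ('a set \<Rightarrow> nat) \<Rightarrow> bool" where
  "edge_colouring k G c \<longleftrightarrow> (\<forall>e\<in>uedges G. c e \<in> {1..k})"

definition colour_balanced :: "nat \<Rightarrow> ('a set \<Rightarrow> nat) \<Rightarrow> 'a ugraph \<Rightarrow> bool" where
  "colour_balanced k c H \<longleftrightarrow>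
     (\<forall>i\<in>{1..k}. \<forall>j\<in>{1..k}. card {e \<in> uedges H. c e = i} = card {e \<in> uedges H. c e = j})"

end

theory Submission
  imports Defs
begin

text \<open>
  A balanced spanning tree is an independent transversal, in the graphic matroid, of the family
  that lists each colour class \<open>2t\<close> times.  By Rado's theorem one exists as soon as the edges with
  colours in \<open>S\<close> have rank at least \<open>2t|S|\<close> for every \<open>S\<close>, and this holds because
  a graph of rank \<open>r\<close> has at most \<open>(r + 1) choose 2\<close> edges.
\<close>

section \<open>Rado's theorem\<close>

text \<open>Add the elements of a set \<open>D\<close> one at a time to \<open>A\<close> and to the
  smaller set \<open>A \<inter> B\<close>. Each addition gains at most as much on the larger side,
  and the gains telescope; \<open>D = B\<close> gives the claim.\<close>

lemma submodular_if_diminishing: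
  fixes f :: "'e set \<Rightarrow> nat"
  assumes dim: "\<And>A B e. A \<subseteq> B \<Longrightarrow> B \<subseteq> E \<Longrightarrow> e \<in> E \<Longrightarrow>
      f (insert e B) + f A \<le> f B + f (insert e A)"
    and E: "finite E" "A \<subseteq> E" "B \<subseteq> E"
  shows "f (A \<union> B) + f (A \<inter> B) \<le> f A + f B"
proof -
  have "f (A \<union> D) + f (A \<inter> B) \<le> f A + f (A \<inter> B \<union> D)" if "finite D" "D \<subseteq> E" for D
    using that
  proof (induction D)
    case (insert e D)
    have "f (insert e (A \<union> D)) + f (A \<inter> B \<union> D) \<le> f (A \<union> D) + f (insert e (A \<inter> B \<union> D))"
      using insert.prems E by (intro dim) auto
    with insert show ?case by simp
  qed simp
  from this[of B] show ?thesis
    using E finite_subset by (metis sup.absorb2 inf_le2)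
qed

text \<open>Sets with two elements are shrunk one element at a time, keeping the Hall-type
  condition, until all are singletons. When \<open>f\<close> is a matroid rank, hence bounded by
  cardinality, the conclusion says that \<open>x\<close> is injective on \<open>I\<close> with
  independent image.\<close>

theorem Rado_transversal:
  fixes f :: "'e set \<Rightarrow> nat" and A :: "'i \<Rightarrow> 'e set"
  assumes E: "finite E" and f0: "f {} = 0"
    and mono: "\<And>X Y. X \<subseteq> Y \<Longrightarrow> Y \<subseteq> E \<Longrightarrow> f X \<le> f Y"
    and submod: "\<And>X Y. X \<subseteq> E \<Longrightarrow> Y \<subseteq> E \<Longrightarrow> f (X \<union> Y) + f (X \<inter> Y) \<le> f X + f Y"
    and I: "finite I" and "\<And>i. i \<in> I \<Longrightarrow> A i \<subseteq> E"
    and "\<And>J. J \<subseteq> I \<Longrightarrow> card J \<le> f (\<Union>(A ` J))"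
  obtains x where "\<And>i. i \<in> I \<Longrightarrow> x i \<in> A i" and "\<And>J. J \<subseteq> I \<Longrightarrow> card J \<le> f (x ` J)"
proof -
  have "\<exists>x. (\<forall>i\<in>I. x i \<in> A i) \<and> (\<forall>J\<subseteq>I. card J \<le> f (x ` J))"
    using assms(6,7)
  proof (induction "\<Sum>i\<in>I. card (A i)" arbitrary: A rule: less_induct)
    case less
    have fin: "finite (A i)" if "i \<in> I" for i
      using less.prems(1) that E finite_subset by blast
    show ?case
    proof (cases "\<exists>i\<in>I. \<exists>y\<in>A i. \<exists>z\<in>A i. y \<noteq> z")
      case False
      \<comment> \<open>Nothing is left to choose: the condition for one-element \<open>J\<close>
        and \<open>f {} = 0\<close> exclude empty sets, and for singletons the condition is already
        the conclusion.\<close>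
      have "\<exists>y. A i = {y}" if "i \<in> I" for i
      proof -
        have "card {i} \<le> f (A i)" using less.prems(2)[of "{i}"] that by simp
        then have "A i \<noteq> {}" using f0 by auto
        then show ?thesis using False that by blast
      qed
      then obtain x where x: "\<And>i. i \<in> I \<Longrightarrow> A i = {x i}" by metis
      have "card J \<le> f (x ` J)" if "J \<subseteq> I" for J
      proof -
        have "\<Union>(A ` J) = x ` J" using x that by auto
        then show ?thesis using less.prems(2)[OF that] by simp
      qed
      then show ?thesis using x by auto
    next
      case True
      then obtain i y z where i: "i \<in> I" and yz: "y \<in> A i" "z \<in> A i" "y \<noteq> z" by blast
      \<comment> \<open>If the condition survives the deletion of \<open>w\<close> from
        \<open>A i\<close>, the induction hypothesis applies, since the total size of the sets
        drops.\<close>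
      have shrink: ?thesis
        if w: "w \<in> A i" and cond: "\<And>J. J \<subseteq> I \<Longrightarrow> card J \<le> f (\<Union>((A(i := A i - {w})) ` J))" for w
      proof -
        let ?B = "A(i := A i - {w})"
        have "(\<Sum>j\<in>I. card (?B j)) < (\<Sum>j\<in>I. card (A j))"
        proof (rule sum_strict_mono_ex1[OF I])
          show "\<forall>j\<in>I. card (?B j) \<le> card (A j)"
            using fin by (auto intro: card_mono)
          show "\<exists>j\<in>I. card (?B j) < card (A j)"
            using card_Diff1_less[OF fin[OF i] w] i by (intro bexI[of _ i]) simp_all
        qed
        moreover have "?B j \<subseteq> E" if "j \<in> I" for j
          using less.prems(1)[OF that] by auto
        ultimately have "\<exists>x. (\<forall>j\<in>I. x j \<in> ?B j) \<and> (\<forall>J\<subseteq>I. card J \<le> f (x ` J))"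
          using cond by (intro less.hyps) blast+
        then obtain x where x: "\<forall>j\<in>I. x j \<in> ?B j" "\<forall>J\<subseteq>I. card J \<le> f (x ` J)" by blast
        have "\<forall>j\<in>I. x j \<in> A j"
          using x(1) by (metis DiffD1 fun_upd_apply)
        with x(2) show ?thesis by blast
      qed
      \<comment> \<open>A family that violates the condition must contain \<open>i\<close>, as the
        other sets are unchanged. It is recorded without \<open>i\<close>, which turns the strict
        inequality into \<open>\<le>\<close>.\<close>
      have violation: "\<exists>J. J \<subseteq> I \<and> i \<notin> J \<and> f ((A i - {w}) \<union> \<Union>(A ` J)) \<le> card J"
        if neg: "\<not> (\<forall>J\<subseteq>I. card J \<le> f (\<Union>((A(i := A i - {w})) ` J)))" for w
      proof -
        obtain J where J: "J \<subseteq> I" "f (\<Union>((A(i := A i - {w})) ` J)) < card J"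
          using neg by (meson not_le)
        have "i \<in> J"
        proof (rule ccontr)
          assume "i \<notin> J"
          then have "\<Union>((A(i := A i - {w})) ` J) = \<Union>(A ` J)" by auto
          then show False using J less.prems(2)[of J] by simp
        qed
        moreover from this have "\<Union>((A(i := A i - {w})) ` J) = (A i - {w}) \<union> \<Union>(A ` (J - {i}))"
          by (auto split: if_splits)
        moreover have "card J = Suc (card (J - {i}))"
          using \<open>i \<in> J\<close> J(1) I finite_subset by (metis card.remove)
        ultimately show ?thesis using J by (intro exI[of _ "J - {i}"]) auto
      qed
      show ?thesis
      proof (rule ccontr)
        assume neg: "\<not> ?thesis"
        obtain J where J: "J \<subseteq> I" "i \<notin> J" "f ((A i - {y}) \<union> \<Union>(A ` J)) \<le> card J"
          using violation[of y] shrink[OF yz(1)] neg by blast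
        obtain K where K: "K \<subseteq> I" "i \<notin> K" "f ((A i - {z}) \<union> \<Union>(A ` K)) \<le> card K"
          using violation[of z] shrink[OF yz(2)] neg by blast
        \<comment> \<open>Since \<open>y \<noteq> z\<close>, the union of \<open>?X\<close> and
          \<open>?Y\<close> recovers all of \<open>A i\<close>, so its value is at least
          \<open>card (J \<union> K) + 1\<close>; the intersection has value at least
          \<open>card (J \<inter> K)\<close>. By submodularity these add up to at most
          \<open>card J + card K\<close>, which is one too few.\<close>
        let ?X = "(A i - {y}) \<union> \<Union>(A ` J)" and ?Y = "(A i - {z}) \<union> \<Union>(A ` K)"
        have sub: "?X \<subseteq> E" "?Y \<subseteq> E" using J(1) K(1) i less.prems(1) by blast+
        have finJK: "finite J" "finite K" using J(1) K(1) I finite_subset by auto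
        have "Suc (card (J \<union> K)) = card (insert i (J \<union> K))"
          using J(2) K(2) finJK by simp
        also have "\<dots> \<le> f (\<Union>(A ` insert i (J \<union> K)))"
          using J(1) K(1) i by (intro less.prems(2)) auto
        also have "\<dots> \<le> f (?X \<union> ?Y)"
          using sub yz(3) by (intro mono) auto
        finally have "Suc (card (J \<union> K)) \<le> f (?X \<union> ?Y)" .
        moreover have "card (J \<inter> K) \<le> f (\<Union>(A ` (J \<inter> K)))"
          using J(1) by (intro less.prems(2)) auto
        moreover have "f (\<Union>(A ` (J \<inter> K))) \<le> f (?X \<inter> ?Y)"
          using sub by (intro mono) auto
        ultimately show False
          using submod[OF sub] J(3) K(3) card_Un_Int[OF finJK] by linarith
      qed
    qed
  qed
  with that show thesis by blast
qed

section \<open>The rank of a set of edges\<close>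

text \<open>Living on the whole type makes this an equivalence for every \<open>A\<close>; the
  vertex set enters only when the quotient is taken.\<close>

definition edge_conn :: "'a set set \<Rightarrow> ('a \<times> 'a) set" where
  "edge_conn A = {(x, y). {x, y} \<in> A}\<^sup>*"

text \<open>The rank function of the graphic matroid: vertices minus components. For finite
  \<open>V\<close> the subtraction is never truncated.\<close>

definition edge_rank :: "'a set \<Rightarrow> 'a set set \<Rightarrow> nat" where
  "edge_rank V A = card V - card (V // edge_conn A)"

section \<open>Connectivity, components and the effect of one new edge\<close>

lemma equiv_edge_conn: "equiv UNIV (edge_conn A)"
proof -
  have "sym {(x, y). {x, y} \<in> A}" by (auto intro!: symI simp: insert_commute)
  then show ?thesis
    unfolding edge_conn_def
    by (intro equivI) (auto intro: refl_rtrancl sym_rtrancl trans_rtrancl)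
qed

lemma edge_conn_mono: "A \<subseteq> B \<Longrightarrow> edge_conn A \<subseteq> edge_conn B"
  unfolding edge_conn_def by (intro rtrancl_mono) auto

lemma edge_conn_sym: "(u, v) \<in> edge_conn A \<Longrightarrow> (v, u) \<in> edge_conn A"
  using equiv_edge_conn by (metis equivE symE)

lemma edge_conn_trans:
  "(u, v) \<in> edge_conn A \<Longrightarrow> (v, w) \<in> edge_conn A \<Longrightarrow> (u, w) \<in> edge_conn A"
  unfolding edge_conn_def by (rule rtrancl_trans)

lemma edge_conn_refl: "(u, u) \<in> edge_conn A"
  unfolding edge_conn_def by simp

lemma edge_conn_edge: "{u, v} \<in> A \<Longrightarrow> (u, v) \<in> edge_conn A"
  unfolding edge_conn_def by auto

lemma edge_conn_class_subset:
  assumes "A \<subseteq> Pow V" "u \<in> V"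
  shows "edge_conn A `` {u} \<subseteq> V"
proof
  fix v assume "v \<in> edge_conn A `` {u}"
  then have "(u, v) \<in> {(x, y). {x, y} \<in> A}\<^sup>*" by (simp add: edge_conn_def)
  then show "v \<in> V" by (induction rule: rtrancl_induct) (use assms in auto)
qed

text \<open>A path through the new edge can be shortened so that it crosses this edge at most once,
  in one of its two directions.\<close>

lemma edge_conn_insert:
  "(u, v) \<in> edge_conn (insert {x, y} A) \<longleftrightarrow>
    (u, v) \<in> edge_conn A \<or> (u, x) \<in> edge_conn A \<and> (y, v) \<in> edge_conn A
      \<or> (u, y) \<in> edge_conn A \<and> (x, v) \<in> edge_conn A" (is "?L \<longleftrightarrow> ?R")
proof
  assume ?L
  then have "(u, v) \<in> {(a, b). {a, b} \<in> insert {x, y} A}\<^sup>*" by (simp add: edge_conn_def)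
  then show ?R
  proof (induction rule: rtrancl_induct)
    case (step v w)
    then have "(v, w) \<in> edge_conn A \<or> v = x \<and> w = y \<or> v = y \<and> w = x"
      using edge_conn_edge[of v w A] by (auto simp: doubleton_eq_iff)
    with step.IH show ?case
      by (metis edge_conn_trans edge_conn_refl edge_conn_sym)
  qed (simp add: edge_conn_refl)
next
  let ?R' = "edge_conn (insert {x, y} A)"
  have xy: "(x, y) \<in> ?R'" by (simp add: edge_conn_edge)
  have sub: "(a, b) \<in> edge_conn A \<Longrightarrow> (a, b) \<in> ?R'" for a b
    using edge_conn_mono[of A "insert {x, y} A"] by blast
  assume ?R
  then show ?L
    using edge_conn_trans[OF edge_conn_trans[OF sub xy] sub]
      edge_conn_trans[OF edge_conn_trans[OF sub edge_conn_sym[OF xy]] sub] sub by blast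
qed

lemma edge_conn_insert_conn:
  assumes "(x, y) \<in> edge_conn A"
  shows "edge_conn (insert {x, y} A) = edge_conn A"
proof (rule set_eqI, clarify)
  fix u v
  show "(u, v) \<in> edge_conn (insert {x, y} A) \<longleftrightarrow> (u, v) \<in> edge_conn A"
    unfolding edge_conn_insert using assms by (metis edge_conn_trans edge_conn_sym)
qed

lemma card_components_le: "finite V \<Longrightarrow> card (V // edge_conn A) \<le> card V"
  unfolding quotient_def by (simp add: UNION_singleton_eq_range card_image_le)

lemma edge_rank_add_components:
  "finite V \<Longrightarrow> edge_rank V A + card (V // edge_conn A) = card V"
  by (simp add: edge_rank_def card_components_le)

lemma components_disjoint:
  assumes "C \<in> V // edge_conn A" "D \<in> V // edge_conn A" "C \<noteq> D"
  shows "C \<inter> D = {}"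
proof -
  have "V // edge_conn A \<subseteq> UNIV // edge_conn A" by (auto simp: quotient_def)
  then show ?thesis using quotient_disj[OF equiv_edge_conn, of C A D] assms by blast
qed

lemma edge_rank_empty: "edge_rank V {} = 0"
proof -
  have "edge_conn {} = (Id :: ('a \<times> 'a) set)" by (simp add: edge_conn_def)
  then have "V // edge_conn {} = (\<lambda>x. {x}) ` V" by (auto simp: quotient_def)
  then show ?thesis by (simp add: edge_rank_def card_image)
qed

text \<open>An edge inside a component leaves connectivity unchanged; an edge between two components
  fuses these two and no others, so the number of components falls by one.\<close>

lemma edge_rank_insert:
  assumes V: "finite V" "x \<in> V" "y \<in> V"
  shows "edge_rank V (insert {x, y} A) = edge_rank V A + (if (x, y) \<in> edge_conn A then 0 else 1)"
proof (cases "(x, y) \<in> edge_conn A")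
  case True
  then show ?thesis by (simp add: edge_rank_def edge_conn_insert_conn)
next
  case False
  let ?R = "edge_conn A" and ?R' = "edge_conn (insert {x, y} A)"
  let ?X = "?R `` {x}" and ?Y = "?R `` {y}"
  let ?Q = "V // ?R"
  have merged: "?R' `` {u} = (if u \<in> ?X \<union> ?Y then ?X \<union> ?Y else ?R `` {u})" for u
  proof (rule set_eqI)
    fix v
    show "v \<in> ?R' `` {u} \<longleftrightarrow> v \<in> (if u \<in> ?X \<union> ?Y then ?X \<union> ?Y else ?R `` {u})"
      by (simp add: edge_conn_insert) (metis edge_conn_sym edge_conn_trans)
  qed
  have "?X \<noteq> ?Y" using False edge_conn_refl[of y A] by auto
  have XQ: "?X \<in> ?Q" "?Y \<in> ?Q" using V by (auto intro: quotientI)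
  \<comment> \<open>The fused class has to be new for the count: two classes leave and exactly one
    enters. As an old class it would meet, hence equal, both \<open>?X\<close> and
    \<open>?Y\<close>.\<close>
  have notin: "?X \<union> ?Y \<notin> ?Q"
  proof
    assume Q: "?X \<union> ?Y \<in> ?Q"
    have "x \<in> ?X" "y \<in> ?Y" by (auto simp: edge_conn_refl)
    then have "?X = ?X \<union> ?Y" "?Y = ?X \<union> ?Y"
      using components_disjoint[OF XQ(1) Q] components_disjoint[OF XQ(2) Q] by blast+
    then show False using \<open>?X \<noteq> ?Y\<close> by simp
  qed
  have class_eq: "?R `` {u} \<in> {?X, ?Y} \<longleftrightarrow> u \<in> ?X \<union> ?Y" for u
    using eq_equiv_class_iff[OF equiv_edge_conn, of _ _ A] by (auto intro: edge_conn_sym)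
  have "V // ?R' = insert (?X \<union> ?Y) (?Q - {?X, ?Y})" (is "?L = ?M")
  proof
    show "?L \<subseteq> ?M"
    proof
      fix C assume "C \<in> ?L"
      then obtain u where u: "u \<in> V" "C = ?R' `` {u}" by (auto elim: quotientE)
      then show "C \<in> ?M"
        using merged[of u] class_eq[of u] quotientI[OF u(1), of ?R] by (auto split: if_splits)
    qed
    have "?X \<union> ?Y \<in> ?L"
      using quotientI[OF V(2), of ?R'] merged[of x] edge_conn_refl[of x A] by simp
    moreover have "C \<in> ?L" if C: "C \<in> ?Q - {?X, ?Y}" for C
    proof -
      obtain u where u: "u \<in> V" "C = ?R `` {u}" using C by (auto elim: quotientE)
      then have "u \<notin> ?X \<union> ?Y" using C class_eq[of u] by blast
      then have "C = ?R' `` {u}" using u merged[of u] by simp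
      then show ?thesis using quotientI[OF u(1), of ?R'] by simp
    qed
    ultimately show "?M \<subseteq> ?L" by blast
  qed
  moreover have finQ: "finite ?Q"
    using V(1) by (simp add: quotient_def)
  moreover have "card (?Q - {?X, ?Y}) + 2 = card ?Q"
    using card_Diff_subset[of "{?X, ?Y}" ?Q] card_mono[OF finQ, of "{?X, ?Y}"] XQ \<open>?X \<noteq> ?Y\<close> by simp
  ultimately have "card (V // ?R') + 1 = card ?Q"
    using notin by simp
  then show ?thesis
    using edge_rank_add_components[OF V(1), of A]
      edge_rank_add_components[OF V(1), of "insert {x, y} A"] False by simp
qed

section \<open>Rank axioms and the bound on the number of edges\<close>

lemma complete_edge_cases:
  assumes "e \<in> uedges (complete_ugraph V)"
  obtains x y where "e = {x, y}" "x \<noteq> y" "x \<in> V" "y \<in> V"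
  using assms by (auto simp: complete_ugraph_def card_2_iff)

lemma finite_complete_edges: "finite V \<Longrightarrow> finite (uedges (complete_ugraph V))"
  by (simp add: complete_ugraph_def)

text \<open>Connectivity only grows from \<open>A\<close> to \<open>B\<close>, so an edge that joins
  two components over \<open>B\<close> also does so over \<open>A\<close>.\<close>

lemma edge_rank_diminishing:
  assumes "finite V" "A \<subseteq> B" "e \<in> uedges (complete_ugraph V)"
  shows "edge_rank V (insert e B) + edge_rank V A \<le> edge_rank V B + edge_rank V (insert e A)"
proof -
  obtain x y where "e = {x, y}" "x \<in> V" "y \<in> V" using assms(3) by (rule complete_edge_cases)
  then show ?thesis
    using edge_rank_insert[OF assms(1)] edge_conn_mono[OF assms(2)] by auto
qed

lemma edge_rank_mono:
  assumes "finite V" "A \<subseteq> B"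
  shows "edge_rank V A \<le> edge_rank V B"
proof -
  \<comment> \<open>Sending each component of \<open>A\<close> to the component of \<open>B\<close>
    around it is surjective, so \<open>B\<close> has no more components than
    \<open>A\<close>.\<close>
  have "V // edge_conn B = (\<lambda>C. edge_conn B `` C) ` (V // edge_conn A)"
  proof -
    have "edge_conn B `` (edge_conn A `` {u}) = edge_conn B `` {u}" for u
      using edge_conn_mono[OF assms(2)]
      by (auto intro: edge_conn_trans edge_conn_refl)
    then show ?thesis by (auto simp: quotient_def)
  qed
  then have "card (V // edge_conn B) \<le> card (V // edge_conn A)"
    using assms(1) by (simp add: quotient_def card_image_le)
  then show ?thesis by (simp add: edge_rank_def)
qed

text \<open>Starting from rank 0, each added edge raises the rank by at most one.\<close>

lemma edge_rank_le_card:
  assumes "finite V" "A \<subseteq> uedges (complete_ugraph V)"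
  shows "edge_rank V A \<le> card A"
proof -
  have "finite A" using assms finite_complete_edges finite_subset by blast
  then show ?thesis using assms(2)
  proof (induction A)
    case (insert e A)
    obtain x y where "e = {x, y}" "x \<in> V" "y \<in> V"
      using insert.prems by (auto elim: complete_edge_cases)
    then show ?case using insert edge_rank_insert[OF assms(1), of x y A] by auto
  qed (simp add: edge_rank_empty)
qed

text \<open>Superadditivity of \<open>Suc n choose 2\<close>: for two summands \<open>a\<close> and
  \<open>b\<close> the right side exceeds the left by \<open>a * b\<close>.\<close>

lemma sum_choose_two_le:
  fixes d :: "'b \<Rightarrow> nat"
  shows "finite Q \<Longrightarrow> (\<Sum>C\<in>Q. Suc (d C) choose 2) \<le> Suc (\<Sum>C\<in>Q. d C) choose 2"
proof (induction Q rule: finite_induct)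
  case (insert C Q)
  have "(Suc a choose 2) + (Suc b choose 2) \<le> Suc (a + b) choose 2" for a b :: nat
    by (induction b) (simp_all add: numeral_2_eq_2)
  from this[of "d C" "sum d Q"] show ?case using insert by simp
qed simp

text \<open>Every edge lies inside one component, and a component with \<open>n\<close> vertices
  adds \<open>n - 1\<close> to the rank and at most \<open>n choose 2\<close> edges. By
  superadditivity, putting all the rank into a single clique is extremal.\<close>

lemma card_edges_le_rank_choose:
  assumes V: "finite V" and A: "A \<subseteq> uedges (complete_ugraph V)"
  shows "card A \<le> Suc (edge_rank V A) choose 2"
proof -
  let ?Q = "V // edge_conn A"
  have AV: "A \<subseteq> Pow V" using A by (auto simp: complete_ugraph_def)
  have finQ: "finite ?Q" using V by (simp add: quotient_def)
  have CV: "C \<subseteq> V" if "C \<in> ?Q" for C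
    using that edge_conn_class_subset[OF AV] by (elim quotientE) blast
  have finC: "finite C" if "C \<in> ?Q" for C
    using CV[OF that] V finite_subset by blast
  \<comment> \<open>Classes are nonempty, so \<open>card C - 1\<close> is a true difference and can
    serve as the \<open>d C\<close> of \<open>sum_choose_two_le\<close>.\<close>
  have pos: "card C = Suc (card C - 1)" if C: "C \<in> ?Q" for C
  proof -
    obtain u where "C = edge_conn A `` {u}" using C by (rule quotientE)
    then have "u \<in> C" by (simp add: edge_conn_refl)
    then have "C \<noteq> {}" by blast
    then show ?thesis using finC[OF C] by (simp add: card_gt_0_iff)
  qed
  have "V = \<Union>?Q"
    using CV by (auto simp: quotient_def intro: edge_conn_refl)
  then have "card V = (\<Sum>C\<in>?Q. card C)"
    using card_Union_disjoint[of ?Q] finC components_disjoint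
    by (metis (no_types, lifting) disjnt_def pairwiseI)
  also have "\<dots> = (\<Sum>C\<in>?Q. Suc (card C - 1))" using pos by (intro sum.cong) auto
  also have "\<dots> = (\<Sum>C\<in>?Q. card C - 1) + card ?Q" by (simp add: sum_Suc)
  finally have rank: "edge_rank V A = (\<Sum>C\<in>?Q. card C - 1)"
    using edge_rank_add_components[OF V, of A] by simp
  have "A \<subseteq> (\<Union>C\<in>?Q. {e. e \<subseteq> C \<and> card e = 2})"
  proof
    fix e assume "e \<in> A"
    then obtain x y where e: "e = {x, y}" "x \<noteq> y" "x \<in> V"
      using A by (blast elim: complete_edge_cases)
    then have "{x, y} \<subseteq> edge_conn A `` {x}"
      using \<open>e \<in> A\<close> by (auto simp: edge_conn_refl edge_conn_edge)
    then show "e \<in> (\<Union>C\<in>?Q. {e. e \<subseteq> C \<and> card e = 2})"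
      using e quotientI[of x V "edge_conn A"] by auto
  qed
  then have "card A \<le> card (\<Union>C\<in>?Q. {e. e \<subseteq> C \<and> card e = 2})"
    using finQ finC by (intro card_mono) auto
  also have "\<dots> \<le> (\<Sum>C\<in>?Q. card {e. e \<subseteq> C \<and> card e = 2})"
    by (rule card_UN_le[OF finQ])
  also have "\<dots> = (\<Sum>C\<in>?Q. Suc (card C - 1) choose 2)"
    using n_subsets finC pos by (intro sum.cong) auto
  also have "\<dots> \<le> Suc (\<Sum>C\<in>?Q. card C - 1) choose 2"
    by (rule sum_choose_two_le[OF finQ])
  finally show ?thesis by (simp add: rank)
qed

section \<open>Bases are spanning trees\<close>

lemma uwalk_if_edge_conn:
  assumes "(u, v) \<in> edge_conn A" "A \<subseteq> Pow V" "u \<in> V"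
  shows "\<exists>p. uwalk \<lparr>uverts = V, uedges = A\<rparr> p \<and> hd p = u \<and> last p = v"
  using assms(1) unfolding edge_conn_def
proof (induction rule: rtrancl_induct)
  case base
  show ?case by (intro exI[of _ "[u]"]) (simp add: uwalk_def assms)
next
  case (step v w)
  then obtain p where "uwalk \<lparr>uverts = V, uedges = A\<rparr> p" "hd p = u" "last p = v" by blast
  then show ?case
    using step.hyps assms(2)
    by (intro exI[of _ "p @ [w]"]) (auto simp: uwalk_def successively_append_iff)
qed

lemma edge_conn_if_successively:
  assumes "successively (\<lambda>x y. {x, y} \<in> A) p" "p \<noteq> []"
  shows "(hd p, last p) \<in> edge_conn A"
  using assms
proof (induction p rule: induct_list012)
  case (3 x y zs)
  then have "(y, last (y # zs)) \<in> edge_conn A" "(x, y) \<in> edge_conn A"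
    by (simp_all add: edge_conn_edge)
  then show ?case by (simp add: edge_conn_trans[of x y])
qed (simp_all add: edge_conn_refl)

lemma ucycle_closing_edge_redundant:
  assumes "ucycle \<lparr>uverts = V, uedges = A\<rparr> p"
  shows "(last p, hd p) \<in> edge_conn (A - {{last p, hd p}})"
proof -
  have p: "successively (\<lambda>x y. {x, y} \<in> A) p" "3 \<le> length p" "distinct p" "p \<noteq> []"
    using assms by (auto simp: ucycle_def uwalk_def)
  \<comment> \<open>With distinct vertices and length at least 3, no two consecutive positions are
    the first and the last. The rest of the cycle thus joins the ends of the closing edge without
    using it.\<close>
  have "{p ! i, p ! Suc i} \<noteq> {last p, hd p}" if "Suc i < length p" for i
    using p that by (auto simp: doubleton_eq_iff last_conv_nth hd_conv_nth nth_eq_iff_index_eq)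
  then have "successively (\<lambda>x y. {x, y} \<in> A - {{last p, hd p}}) p"
    using p(1) by (simp add: successively_conv_nth)
  then show ?thesis
    using p(4) by (intro edge_conn_sym[OF edge_conn_if_successively])
qed

text \<open>Rank \<open>card V - 1\<close> leaves exactly one component. A cycle would contain an
  edge whose removal keeps the rank, and then fewer than \<open>card V - 1\<close> edges would have
  rank \<open>card V - 1\<close>.\<close>

lemma utree_if_full_rank:
  assumes V: "finite V" "V \<noteq> {}" and A: "A \<subseteq> uedges (complete_ugraph V)"
    and card: "card A = card V - 1" and rank: "edge_rank V A = card V - 1"
  shows "utree \<lparr>uverts = V, uedges = A\<rparr>"
proof -
  let ?T = "\<lparr>uverts = V, uedges = A\<rparr>"
  have AV: "A \<subseteq> Pow V" using A by (auto simp: complete_ugraph_def)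
  have finA: "finite A" using A V(1) finite_complete_edges finite_subset by blast
  have "simple_ugraph ?T"
    using V A by (auto simp: simple_ugraph_def complete_ugraph_def)
  moreover have "uconnected ?T"
  proof -
    have "card V > 0" using V by (simp add: card_gt_0_iff)
    then have "card (V // edge_conn A) = 1"
      using edge_rank_add_components[OF V(1), of A] rank by simp
    then obtain C where C: "V // edge_conn A = {C}" by (auto simp: card_1_singleton_iff)
    have "(u, v) \<in> edge_conn A" if "u \<in> V" "v \<in> V" for u v
    proof -
      have "edge_conn A `` {u} = edge_conn A `` {v}"
        using quotientI[OF that(1), of "edge_conn A"] quotientI[OF that(2), of "edge_conn A"] C
        by simp
      then show ?thesis using edge_conn_refl[of v A] by blast
    qed
    then show ?thesis
      using V(2) uwalk_if_edge_conn[OF _ AV] by (simp add: uconnected_def)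
  qed
  moreover have "\<not> ucycle ?T p" for p
  proof
    assume cyc: "ucycle ?T p"
    let ?e = "{last p, hd p}"
    have e: "?e \<in> A" using cyc by (simp add: ucycle_def)
    then have "edge_rank V A = edge_rank V (insert ?e (A - {?e}))" by (simp add: insert_absorb)
    also have "\<dots> = edge_rank V (A - {?e})"
      using edge_rank_insert[OF V(1), of "last p" "hd p" "A - {?e}"] e AV
        ucycle_closing_edge_redundant[OF cyc] by auto
    also have "\<dots> \<le> card (A - {?e})" using A V(1) by (intro edge_rank_le_card) auto
    also have "\<dots> < card A" using e finA by (rule card_Diff1_less[rotated])
    finally show False using card rank by simp
  qed
  ultimately show ?thesis by (simp add: utree_def)
qed

section \<open>Independent transversals of the repeated colour classes\<close>

theorem theorem1p7:
  fixes k t :: nat and V :: "'a set" and c :: "'a set \<Rightarrow> nat"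
  assumes "k \<ge> 1" and "t \<ge> 1"
    and "finite V" and "card V = 2 * k * t + 1"
    and "edge_colouring k (complete_ugraph V) c"
    and "\<forall>j\<in>{1..k}. \<forall>S. S \<subseteq> {1..k} \<and> card S = j \<longrightarrow>
           card {e \<in> uedges (complete_ugraph V). c e \<in> S} > (2 * j * t) choose 2"
  shows "\<exists>T. uspanning_tree T (complete_ugraph V) \<and> colour_balanced k c T"
proof -
  let ?E = "uedges (complete_ugraph V)" and ?I = "{1..k} \<times> {..<2 * t}"
  \<comment> \<open>The second index \<open>s\<close> only numbers the \<open>2 * t\<close> copies
    of colour class \<open>i\<close>.\<close>
  define A where "A = (\<lambda>(i, s :: nat). {e \<in> ?E. c e = i})"
  note V = assms(3)
  have finE: "finite ?E" by (rule finite_complete_edges[OF V])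
  have AE: "A i \<subseteq> ?E" for i by (auto simp: A_def split: prod.splits)
  have cond: "card J \<le> edge_rank V (\<Union>(A ` J))" if J: "J \<subseteq> ?I" for J
  \<comment> \<open>The empty family is treated apart because the colour hypothesis speaks only of
    \<open>j \<ge> 1\<close>.\<close>
  proof (cases "J = {}")
    case False
    define S where "S = fst ` J"
    have S: "S \<subseteq> {1..k}" using J by (auto simp: S_def)
    then have finS: "finite S" by (rule finite_subset) simp
    have "S \<noteq> {}" using False by (simp add: S_def)
    then have "card S \<in> {1..k}"
      using finS card_mono[OF _ S] by (simp add: Suc_le_eq card_gt_0_iff)
    then have many: "(2 * card S * t) choose 2 < card {e \<in> ?E. c e \<in> S}"
      using assms(6) S by blast
    have U: "\<Union>(A ` J) = {e \<in> ?E. c e \<in> S}" by (force simp: A_def S_def)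
    \<comment> \<open>The union depends only on the set \<open>S\<close> of colours that occur in
      \<open>J\<close>, so the worst case takes all \<open>2 * t\<close> copies of each.\<close>
    have "J \<subseteq> S \<times> {..<2 * t}" using J by (force simp: S_def)
    then have "card J \<le> card (S \<times> {..<2 * t})" using finS by (intro card_mono) auto
    then have "card J \<le> 2 * card S * t" by (simp add: card_cartesian_product mult.commute mult.left_commute)
    moreover have "2 * card S * t \<le> edge_rank V (\<Union>(A ` J))"
    \<comment> \<open>A rank \<open>r < 2 * card S * t\<close> gives
      \<open>Suc r \<le> 2 * card S * t\<close>, hence at most
      \<open>(2 * card S * t) choose 2\<close> edges with colours in \<open>S\<close>, against the
      strict hypothesis.\<close>
    proof (rule ccontr)
      assume "\<not> ?thesis"
      then have "Suc (edge_rank V (\<Union>(A ` J))) choose 2 \<le> (2 * card S * t) choose 2"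
        by (intro binomial_right_mono) simp
      moreover have "card (\<Union>(A ` J)) \<le> Suc (edge_rank V (\<Union>(A ` J))) choose 2"
        using AE by (intro card_edges_le_rank_choose[OF V]) blast
      ultimately show False using many U by simp
    qed
    ultimately show ?thesis by simp
  qed simp
  obtain x where x: "\<And>i. i \<in> ?I \<Longrightarrow> x i \<in> A i"
    and rank: "\<And>J. J \<subseteq> ?I \<Longrightarrow> card J \<le> edge_rank V (x ` J)"
  proof (rule Rado_transversal[of ?E "edge_rank V" ?I A])
    show "edge_rank V (X \<union> Y) + edge_rank V (X \<inter> Y) \<le> edge_rank V X + edge_rank V Y"
      if "X \<subseteq> ?E" "Y \<subseteq> ?E" for X Y
      using edge_rank_diminishing[OF V] finE that by (intro submodular_if_diminishing[of ?E]) auto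
  qed (use finE AE cond edge_rank_empty edge_rank_mono[OF V] in auto)
  let ?F = "x ` ?I"
  have FE: "?F \<subseteq> ?E" using x AE by blast
  have cardI: "card ?I = card V - 1" using assms(4) by simp
  \<comment> \<open>All inequalities in
    \<open>card ?I \<le> edge_rank V ?F \<le> card ?F \<le> card ?I\<close> are equalities, so the
    chosen edges are distinct and independent; there are \<open>2 * k * t = card V - 1\<close> of
    them.\<close>
  have cardF: "card ?F = card ?I" and rankF: "edge_rank V ?F = card ?I"
    using rank[of ?I] edge_rank_le_card[OF V FE] card_image_le[of ?I x] by auto
  have inj: "inj_on x ?I" using cardF by (intro eq_card_imp_inj_on) auto
  let ?T = "\<lparr>uverts = V, uedges = ?F\<rparr>"
  have "V \<noteq> {}" using assms(4) by auto
  then have tree: "utree ?T"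
    using utree_if_full_rank[OF V _ FE] cardF rankF cardI by simp
  then have "uspanning_tree ?T (complete_ugraph V)"
    using FE by (simp add: uspanning_tree_def usubgraph_def utree_def complete_ugraph_def)
  moreover have "card {e \<in> ?F. c e = i} = 2 * t" if "i \<in> {1..k}" for i
  proof -
    \<comment> \<open>The first index can be read off from the colour of the chosen edge, so the
      edges of colour \<open>i\<close> are exactly those chosen for its \<open>2 * t\<close>
      copies.\<close>
    have col: "c (x (j, s)) = j" if "(j, s) \<in> ?I" for j s using x[OF that] by (simp add: A_def)
    have "{e \<in> ?F. c e = i} = x ` ({i} \<times> {..<2 * t})" using that col by force
    moreover have "inj_on x ({i} \<times> {..<2 * t})"
      using that by (intro inj_on_subset[OF inj]) auto
    ultimately show ?thesis by (simp add: card_image card_cartesian_product)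
  qed
  ultimately show ?thesis by (intro exI[of _ ?T]) (simp add: colour_balanced_def)
qed

end
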